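(* Let $a>0$, $b\in\mathbb{C}$ and $\upsilon\in\mathbb{C}$. For $x>0$ define $$\Upsilon(\upsilon,a,b,x)=\sum_{k=0}^{\infty}\left(\frac{b^{2k+1}a^{-k+\frac{\upsilon}{2}-1}\,\Gamma\left(k-\frac{\upsilon}{2}+1,\,ax^{2}\right)}{2(2k+1)!}-\frac{b^{2k}a^{-k+\frac{\upsilon}{2}-\frac12}\,\Gamma\left(k-\frac{\upsilon}{2}+\frac12,\,ax^{2}\right)}{2(2k)!}\right).$$ Then the series converges and $\Upsilon(\upsilon,a,b,\cdot)$ is an antiderivative on $(0,\infty)$ of $x\mapsto x^{-\upsilon}e^{-ax^{2}-bx}$, i.e. $$\int\frac{e^{-ax^{2}-bx}}{x^{\upsilon}}\,dx=\Upsilon(\upsilon,a,b,x).$$ Moreover, when $b>0$ this integral equals $\int\sqrt{\tfrac{2}{\pi}}\,e^{-ax^{2}}\,b^{\frac12}x^{\frac12-\upsilon}K_{\frac12}(bx)\,dx$ (the two integrands coincide on $(0,\infty)$).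
   Context: $\Gamma(s,z)=\int_z^\infty t^{s-1}e^{-t}\,dt$ is the upper incomplete gamma function (for $z>0$, $s\in\mathbb{C}$). $K_\mu$ is the Macdonald function (modified Bessel function of the second kind). For $x>0$, $x^{-\upsilon}=e^{-\upsilon\ln x}$. Here $\int f\,dx=F$ means that $F$ is differentiable on $(0,\infty)$ with $F'=f$. *)

theory Defs
  imports "HOL-Complex_Analysis.Complex_Analysis"
begin

text \<open>
  Only the case \<open>z > 0\<close> is meaningful; there the integrand is absolutely integrable
  for every complex \<open>s\<close>.
\<close>
definition upper_Gamma :: "complex \<Rightarrow> real \<Rightarrow> complex" where
  "upper_Gamma s z = integral {z..} (\<lambda>t. of_real t powr (s - 1) * of_real (exp (- t)))"

text \<open>
  Principal branch of the modified Bessel function of the first kind. Using \<open>rGamma\<close>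
  (the entire function \<open>1 / Gamma\<close>) makes the series correct for negative integer orders too.
\<close>
definition Bessel_I :: "complex \<Rightarrow> complex \<Rightarrow> complex" where
  "Bessel_I \<mu> z = (\<Sum>k. (z / 2) powr (\<mu> + 2 * of_nat k) * rGamma (\<mu> + of_nat k + 1) / fact k)"

definition Macdonald_quotient :: "complex \<Rightarrow> complex \<Rightarrow> complex" where
  "Macdonald_quotient \<mu> z =
     of_real pi / 2 * (Bessel_I (- \<mu>) z - Bessel_I \<mu> z) / sin (of_real pi * \<mu>)"

text \<open>At integer orders the quotient is 0/0, and the function is its limit in the order.\<close>
definition Macdonald_K :: "complex \<Rightarrow> complex \<Rightarrow> complex" where
  "Macdonald_K \<mu> z =
     (if \<mu> \<in> \<int> then Lim (at \<mu>) (\<lambda>\<nu>. Macdonald_quotient \<nu> z) else Macdonald_quotient \<mu> z)"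

definition Upsilon_term :: "complex \<Rightarrow> real \<Rightarrow> complex \<Rightarrow> real \<Rightarrow> nat \<Rightarrow> complex" where
  "Upsilon_term \<upsilon> a b x k =
     b ^ (2 * k + 1) * of_real a powr (- of_nat k + \<upsilon> / 2 - 1)
       * upper_Gamma (of_nat k - \<upsilon> / 2 + 1) (a * x\<^sup>2) / (2 * fact (2 * k + 1))
   - b ^ (2 * k) * of_real a powr (- of_nat k + \<upsilon> / 2 - 1 / 2)
       * upper_Gamma (of_nat k - \<upsilon> / 2 + 1 / 2) (a * x\<^sup>2) / (2 * fact (2 * k))"

definition Upsilon :: "complex \<Rightarrow> real \<Rightarrow> complex \<Rightarrow> real \<Rightarrow> complex" where
  "Upsilon \<upsilon> a b x = (\<Sum>k. Upsilon_term \<upsilon> a b x k)"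

definition antiderivative_on_pos :: "(real \<Rightarrow> complex) \<Rightarrow> (real \<Rightarrow> complex) \<Rightarrow> bool" where
  "antiderivative_on_pos F f \<longleftrightarrow> (\<forall>x>0. (F has_vector_derivative f x) (at x))"

end

(*
  Substituting u = sqrt (t / a) in the incomplete gamma functions turns the series into
  minus the integral over {x..} of u^(-v) exp(- a u^2) times the power series of exp(- b u),
  integrated term by term, consecutive terms being grouped in pairs. The m-th integrated term
  is O(2^(-m)), and its derivative is the m-th term of the exponential series times
  x^(-v) exp(- a x^2), which converges locally uniformly. The last claim is
  K_(1/2)(z) = sqrt (pi / (2 z)) exp(- z): the series of I_(-1/2) and I_(1/2) are the even
  and the odd part of the exponential series.
*)
theory Submission
  imports Defs
begin

section \<open>Termwise differentiation of series\<close>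

text \<open>The majorant \<open>M\<close> makes the series of derivatives converge uniformly on
  \<open>S\<close>. With convexity of \<open>S\<close> and convergence at the single point
  \<open>x0\<close>, this yields convergence of the series itself on \<open>S\<close> and its
  derivative; openness of \<open>S\<close> then removes the restriction "within
  \<open>S\<close>".\<close>

lemma has_vector_derivative_suminf_M_test:
  fixes f f' :: "nat \<Rightarrow> real \<Rightarrow> 'a::banach"
  assumes S: "open S" "convex S"
    and deriv: "\<And>n x. x \<in> S \<Longrightarrow> (f n has_vector_derivative f' n x) (at x)"
    and bound: "\<And>n x. x \<in> S \<Longrightarrow> norm (f' n x) \<le> M n" and M: "summable M"
    and x0: "x0 \<in> S" "summable (\<lambda>n. f n x0)"
  shows "((\<lambda>x. \<Sum>n. f n x) has_vector_derivative (\<Sum>n. f' n x0)) (at x0)"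
proof -
  have unif: "uniform_limit S (\<lambda>n x. \<Sum>i<n. f' i x) (\<lambda>x. \<Sum>i. f' i x) sequentially"
    using bound M by (rule Weierstrass_m_test)
  have "\<exists>g. \<forall>x\<in>S. (\<lambda>n. f n x) sums g x \<and>
      (g has_derivative (\<lambda>h. h *\<^sub>R (\<Sum>i. f' i x))) (at x within S)"
  proof (rule has_derivative_series[where f' = "\<lambda>n x h. h *\<^sub>R f' n x"])
    show "(f n has_derivative (\<lambda>h. h *\<^sub>R f' n x)) (at x within S)" if "x \<in> S" for n x
      using deriv[OF that] has_derivative_at_withinI unfolding has_vector_derivative_def by blast
  next
    fix e :: real assume "e > 0"
    with unif have "\<forall>\<^sub>F n in sequentially. \<forall>x\<in>S. dist (\<Sum>i<n. f' i x) (\<Sum>i. f' i x) < e"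
      unfolding uniform_limit_iff by blast
    \<comment> \<open>The derivatives act as the linear maps that send \<open>h\<close> to
      \<open>h *\<^sub>R f' n x\<close>, so a uniform error \<open>e\<close> between partial sums
      and limit becomes the error \<open>e * norm h\<close>.\<close>
    then show "\<forall>\<^sub>F n in sequentially. \<forall>x\<in>S. \<forall>h.
        norm ((\<Sum>i<n. h *\<^sub>R f' i x) - h *\<^sub>R (\<Sum>i. f' i x)) \<le> e * norm h"
    proof eventually_elim
      case (elim n)
      show ?case
      proof (intro ballI allI)
        fix x :: real and h :: real
        assume "x \<in> S"
        have "norm ((\<Sum>i<n. h *\<^sub>R f' i x) - h *\<^sub>R (\<Sum>i. f' i x))
            = norm h * norm ((\<Sum>i<n. f' i x) - (\<Sum>i. f' i x))"
          by (simp only: norm_scaleR real_norm_def flip: scaleR_sum_right scaleR_diff_right)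
        also have "\<dots> \<le> norm h * e"
          using elim \<open>x \<in> S\<close> by (intro mult_left_mono) (auto simp: dist_norm less_imp_le)
        finally show "norm ((\<Sum>i<n. h *\<^sub>R f' i x) - h *\<^sub>R (\<Sum>i. f' i x)) \<le> e * norm h"
          by (simp add: mult.commute)
      qed
    qed
  qed (use S x0 summable_sums in auto)
  then obtain g where g: "\<And>x. x \<in> S \<Longrightarrow> (\<lambda>n. f n x) sums g x"
      "\<And>x. x \<in> S \<Longrightarrow> (g has_derivative (\<lambda>h. h *\<^sub>R (\<Sum>i. f' i x))) (at x within S)"
    by blast
  have "(g has_vector_derivative (\<Sum>i. f' i x0)) (at x0)"
    using g(2)[OF x0(1)] unfolding has_vector_derivative_def at_within_open[OF x0(1) S(1)] .
  then show ?thesis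
    by (rule has_vector_derivative_transform_within_open[OF _ S(1) x0(1)])
      (use g(1) in \<open>auto simp: sums_iff\<close>)
qed

section \<open>The upper incomplete gamma function: integrability and derivative\<close>

lemma powr_le_const_mult_exp:
  fixes c \<epsilon> p :: real
  assumes "c > 0" "\<epsilon> > 0"
  obtains C where "C > 0" "\<And>t. t \<ge> c \<Longrightarrow> t powr p \<le> C * exp (\<epsilon> * t)"
proof (cases "p \<le> 0")
  case True
  show ?thesis
  proof
    show "c powr p > 0" using assms by simp
    fix t assume t: "t \<ge> c"
    have "t powr p \<le> c powr p"
      using t True assms by (intro powr_mono2') auto
    also have "\<dots> \<le> c powr p * exp (\<epsilon> * t)"
      using t assms by (simp add: mult_le_cancel_left1)
    finally show "t powr p \<le> c powr p * exp (\<epsilon> * t)" .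
  qed
next
  case False
  \<comment> \<open>With this scale, ln u \<le> u at u = t / K, multiplied by \<open>p\<close>, has
    right-hand side exactly \<open>\<epsilon> * t\<close>.\<close>
  define K where "K = p / \<epsilon>"
  have K: "K > 0" using False assms by (simp add: K_def)
  show ?thesis
  proof
    show "K powr p > 0" using K by simp
    fix t assume t: "t \<ge> c"
    then have "t > 0" using assms by linarith
    have "ln (t / K) \<le> t / K"
      using ln_bound[of "t / K"] K \<open>t > 0\<close> by simp
    then have "p * ln (t / K) \<le> p * (t / K)"
      using False by (intro mult_left_mono) auto
    also have "p * (t / K) = \<epsilon> * t" using False assms by (simp add: K_def)
    finally have "(t / K) powr p \<le> exp (\<epsilon> * t)"
      using K \<open>t > 0\<close> by (simp add: powr_def)
    then have "K powr p * (t / K) powr p \<le> K powr p * exp (\<epsilon> * t)"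
      by (intro mult_left_mono) auto
    then show "t powr p \<le> K powr p * exp (\<epsilon> * t)"
      using K \<open>t > 0\<close> by (simp flip: powr_mult)
  qed
qed

abbreviation (input) Gamma_integrand :: "complex \<Rightarrow> real \<Rightarrow> complex" where
  "Gamma_integrand s t \<equiv> of_real t powr (s - 1) * of_real (exp (- t))"

lemma norm_Gamma_integrand:
  "t > 0 \<Longrightarrow> norm (Gamma_integrand s t) = t powr (Re s - 1) * exp (- t)"
  by (simp add: norm_mult norm_powr_real_powr)

lemma continuous_on_Gamma_integrand:
  "c > 0 \<Longrightarrow> S \<subseteq> {c..} \<Longrightarrow> continuous_on S (Gamma_integrand s)"
  by (auto intro!: continuous_intros)

text \<open>Half of the decay of exp(-t) absorbs the power of t, leaving a multiple of exp(-t/2) as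
  integrable majorant.\<close>

lemma integrable_Gamma_integrand:
  assumes "c > 0"
  shows "Gamma_integrand s integrable_on {c..}"
proof -
  obtain C where C: "\<And>t. t \<ge> c \<Longrightarrow> t powr (Re s - 1) \<le> C * exp (1/2 * t)"
    using powr_le_const_mult_exp[OF assms, of "1/2" "Re s - 1"] by auto
  show ?thesis
  proof (rule measurable_bounded_by_integrable_imp_integrable)
    show "Gamma_integrand s \<in> borel_measurable (lebesgue_on {c..})"
      using assms by (intro continuous_imp_measurable_on_sets_lebesgue continuous_on_Gamma_integrand) auto
    show "(\<lambda>t. C * exp (- (1/2) * t)) integrable_on {c..}"
      using integrable_on_exp_minus_to_infinity[of "1/2" c] by (intro integrable_on_mult_right) simp
    fix t assume t: "t \<in> {c..}"
    then have "norm (Gamma_integrand s t) = t powr (Re s - 1) * exp (- t)"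
      using assms by (intro norm_Gamma_integrand) auto
    also have "\<dots> \<le> C * exp (1/2 * t) * exp (- t)"
      using C t by (intro mult_right_mono) auto
    also have "\<dots> = C * exp (- (1/2) * t)"
      by (simp flip: exp_add)
    finally show "norm (Gamma_integrand s t) \<le> C * exp (- (1/2) * t)" .
  qed auto
qed

text \<open>The integral is cut at the fixed point \<open>z + 1\<close>: the tail is constant in the
  lower limit, and the fundamental theorem of calculus handles the compact part. Lower limits stay
  above \<open>z / 2\<close>, away from the possible singularity at 0.\<close>

lemma upper_Gamma_has_vector_derivative:
  assumes "z > 0"
  shows "(upper_Gamma s has_vector_derivative - Gamma_integrand s z) (at z)"
proof -
  define I where "I = {z / 2 <..< z + 1}"
  have z: "z \<in> I" "open I" using assms by (auto simp: I_def)
  have "((\<lambda>u. integral {u..z + 1} (Gamma_integrand s)) has_vector_derivative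
      - Gamma_integrand s z) (at z within {z / 2..z + 1})"
    using assms by (intro integral_has_vector_derivative' continuous_on_Gamma_integrand[of "z/2"]) auto
  then have "((\<lambda>u. integral {u..z + 1} (Gamma_integrand s)) has_vector_derivative
      - Gamma_integrand s z) (at z within I)"
    by (rule has_vector_derivative_within_subset) (auto simp: I_def)
  then have "((\<lambda>u. integral {u..z + 1} (Gamma_integrand s)) has_vector_derivative
      - Gamma_integrand s z) (at z)"
    using z by (simp only: at_within_open)
  then have "((\<lambda>u. integral {u..z + 1} (Gamma_integrand s) + upper_Gamma s (z + 1))
      has_vector_derivative - Gamma_integrand s z + 0) (at z)"
    by (intro has_vector_derivative_add has_vector_derivative_const)
  then show ?thesis
    unfolding add_0_right
  proof (rule has_vector_derivative_transform_within_open[OF _ z(2,1)])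
    fix u assume u: "u \<in> I"
    have "{u..} = {u..z + 1} \<union> {z + 1..}" "{u..z + 1} \<inter> {z + 1..} = {z + 1}"
      using u by (auto simp: I_def)
    moreover have "Gamma_integrand s integrable_on {u..z + 1}"
      using u assms by (intro integrable_continuous_real continuous_on_Gamma_integrand[of u])
        (auto simp: I_def)
    ultimately show "integral {u..z + 1} (Gamma_integrand s) + upper_Gamma s (z + 1)
        = upper_Gamma s u"
      unfolding upper_Gamma_def
      using integral_Un[of "Gamma_integrand s" "{u..z + 1}" "{z + 1..}"]
        integrable_Gamma_integrand[of "z + 1" s] assms by simp
  qed
qed

section \<open>The ungrouped terms: derivative and geometric bound\<close>

text \<open>
  Both summands of \<open>Upsilon_term\<close> have this shape, for \<open>m = 2 * k\<close> and \<open>m = 2 * k + 1\<close>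
  respectively.
\<close>
definition Upsilon_half_term :: "complex \<Rightarrow> real \<Rightarrow> complex \<Rightarrow> nat \<Rightarrow> real \<Rightarrow> complex" where
  "Upsilon_half_term \<upsilon> a b m x =
     - ((- b) ^ m / fact m * of_real a powr - ((of_nat m + 1 - \<upsilon>) / 2)
         * upper_Gamma ((of_nat m + 1 - \<upsilon>) / 2) (a * x\<^sup>2) / 2)"

lemma Upsilon_term_eq:
  "Upsilon_term \<upsilon> a b x k
     = Upsilon_half_term \<upsilon> a b (2 * k) x + Upsilon_half_term \<upsilon> a b (2 * k + 1) x"
proof -
  have "- ((of_nat (2 * k) + 1 - \<upsilon>) / 2) = - of_nat k + \<upsilon> / 2 - 1 / 2"
    "(of_nat (2 * k) + 1 - \<upsilon>) / 2 = of_nat k - \<upsilon> / 2 + 1 / 2"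
    "- ((of_nat (2 * k + 1) + 1 - \<upsilon>) / 2) = - of_nat k + \<upsilon> / 2 - 1"
    "(of_nat (2 * k + 1) + 1 - \<upsilon>) / 2 = of_nat k - \<upsilon> / 2 + 1"
    by (simp_all add: field_simps)
  note exponents = this
  show ?thesis
    unfolding Upsilon_half_term_def Upsilon_term_def exponents by (simp add: mult_ac)
qed

text \<open>By the chain rule through a x^2, with s = (m + 1 - \<upsilon>) / 2, the powers of a
  contribute -s + (s - 1) + 1 = 0, and those of x contribute 2 (s - 1) + 1 = m - \<upsilon>. The
  factor 2 cancels the 1/2 in the term.\<close>

lemma Upsilon_half_term_has_vector_derivative:
  assumes "a > 0" "x > 0"
  shows "(Upsilon_half_term \<upsilon> a b m has_vector_derivative
     (- b * of_real x) ^ m / fact m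
       * (of_real x powr - \<upsilon> * exp (- of_real a * (of_real x)\<^sup>2))) (at x)"
proof -
  define s where "s = (of_nat m + 1 - \<upsilon>) / 2"
  define A where "A = (- b) ^ m / fact m * of_real a powr - s / 2"
  have "((\<lambda>x. a * x\<^sup>2) has_vector_derivative 2 * a * x) (at x)"
    unfolding has_real_derivative_iff_has_vector_derivative[symmetric]
    by (auto intro!: derivative_eq_intros)
  then have "(upper_Gamma s \<circ> (\<lambda>x. a * x\<^sup>2) has_vector_derivative
      (2 * a * x) *\<^sub>R (- Gamma_integrand s (a * x\<^sup>2))) (at x)"
    by (rule vector_diff_chain_at)
      (use assms in \<open>intro upper_Gamma_has_vector_derivative, simp\<close>)
  then have "((\<lambda>x. - A * upper_Gamma s (a * x\<^sup>2)) has_vector_derivative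
      - A * ((2 * a * x) *\<^sub>R (- Gamma_integrand s (a * x\<^sup>2)))) (at x)"
    unfolding o_def by (rule has_vector_derivative_mult_right)
  moreover have "- A * ((2 * a * x) *\<^sub>R (- Gamma_integrand s (a * x\<^sup>2)))
      = (- b * of_real x) ^ m / fact m
        * (of_real x powr - \<upsilon> * exp (- of_real a * (of_real x)\<^sup>2))"
  proof -
    let ?a = "complex_of_real a" and ?x = "complex_of_real x"
    have ne: "?a \<noteq> 0" "?x \<noteq> 0" using assms by auto
    \<comment> \<open>Complex powers are multiplicative here because the bases are positive
      reals.\<close>
    have "(?a * ?x\<^sup>2) powr (s - 1) = ?a powr (s - 1) * (?x * ?x) powr (s - 1)"
      using assms by (simp add: powr_times_real power2_eq_square)
    also have "(?x * ?x) powr (s - 1) = ?x powr (s - 1) * ?x powr (s - 1)"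
      using assms by (intro powr_times_real) auto
    also have "?x powr (s - 1) * ?x powr (s - 1) = ?x powr (of_nat m - \<upsilon> - 1)"
    proof -
      have "s - 1 + (s - 1) = of_nat m - \<upsilon> - 1" by (simp add: s_def field_simps)
      then show ?thesis by (simp flip: powr_add)
    qed
    also have "\<dots> = ?x ^ m * ?x powr - \<upsilon> / ?x"
      using ne by (simp add: powr_diff powr_minus_divide)
    finally have 1: "(?a * ?x\<^sup>2) powr (s - 1) = ?a powr (s - 1) * (?x ^ m * ?x powr - \<upsilon> / ?x)" .
    have 2: "?a powr - s * ?a powr (s - 1) * ?a = 1"
      using ne by (simp add: powr_diff powr_minus)
    have "- A * ((2 * a * x) *\<^sub>R (- Gamma_integrand s (a * x\<^sup>2)))
        = (?a powr - s * ?a powr (s - 1) * ?a) * ((- b) ^ m * ?x ^ m / fact m)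
          * (?x powr - \<upsilon> * of_real (exp (- (a * x\<^sup>2))))"
      using ne by (simp add: A_def 1 scaleR_conv_of_real)
    then show ?thesis
      unfolding 2 power_mult_distrib[of "- b" ?x] by (simp flip: exp_of_real)
  qed
  ultimately show ?thesis
    unfolding Upsilon_half_term_def s_def[symmetric] A_def by (simp add: mult_ac)
qed


lemma power_div_fact_le_exp: "(y::real) \<ge> 0 \<Longrightarrow> y ^ n / fact n \<le> exp y"
  using sum_le_suminf[of "\<lambda>n. y ^ n /\<^sub>R fact n" "{n}"] sums_summable[OF exp_converges[of y]]
    sums_unique[OF exp_converges[of y]]
  by (simp add: field_simps)

text \<open>
  The bound comes from \<open>y ^ m / fact m \<le> (1 / 2) ^ m * exp (2 * y)\<close> at
  \<open>y = norm b * sqrt (t / a)\<close> under the integral; \<open>2 * y\<close> is at most \<open>t / 4\<close> up to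
  a constant, so \<open>exp (- t)\<close> absorbs the exponential.
\<close>
lemma Upsilon_half_term_bound:
  assumes "a > 0" "x > 0"
  shows "\<exists>C. \<forall>m. norm (Upsilon_half_term \<upsilon> a b m x) \<le> C * (1 / 2) ^ m"
proof -
  define c where "c = a * x\<^sup>2"
  have c: "c > 0" using assms by (simp add: c_def)
  define \<sigma> where "\<sigma> = (1 - Re \<upsilon>) / 2"
  \<comment> \<open>The rate 1/4 is one half of the budget: this power and the factor
    \<open>exp (2 * y)\<close> each cost exp(t/4), so exp(-t/2) remains of exp(-t).\<close>
  obtain C where C: "C > 0" "\<And>t. t \<ge> c \<Longrightarrow> t powr (\<sigma> - 1) \<le> C * exp (1/4 * t)"
    using powr_le_const_mult_exp[OF c, of "1/4" "\<sigma> - 1"] by auto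
  define B where "B = a powr - \<sigma> * C * exp (4 * (norm b)\<^sup>2 / a)"
  have B: "B > 0" using assms C by (simp add: B_def)
  define J where "J = integral {c..} (\<lambda>t. exp (- (1/2) * t) :: real)"
  have int: "(\<lambda>t. exp (- (1/2) * t) :: real) integrable_on {c..}"
    using integrable_on_exp_minus_to_infinity[of "1/2" c] by simp
  have "norm (Upsilon_half_term \<upsilon> a b m x) \<le> B * J * (1 / 2) ^ m" for m
  proof -
    define s where "s = (of_nat m + 1 - \<upsilon>) / 2"
    define K where "K = (- b) ^ m / fact m * of_real a powr - s"
    have Re_s: "Re s = m / 2 + \<sigma>" by (simp add: s_def \<sigma>_def field_simps)
    have bound: "norm (K * Gamma_integrand s t) \<le> B * (1 / 2) ^ m * exp (- (1/2) * t)"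
      if "t \<in> {c..}" for t
    proof -
      have t: "t > 0" "t \<ge> c" using that c by auto
      define y where "y = norm b * sqrt (t / a)"
      have y: "y \<ge> 0" using t assms by (simp add: y_def)
      \<comment> \<open>The square is chosen so that its cross term is \<open>2 * y\<close> and its
        t-part is exactly t/4.\<close>
      have "0 \<le> (sqrt t / 2 - 2 * (norm b / sqrt a))\<^sup>2" by simp
      also have "\<dots> = t / 4 + 4 * (norm b)\<^sup>2 / a - 2 * y"
        using t assms
        by (simp add: power2_diff power_divide power_mult_distrib y_def real_sqrt_divide)
      finally have "2 * y \<le> t / 4 + 4 * (norm b)\<^sup>2 / a" by simp
      then have "exp (2 * y) \<le> exp (1/4 * t) * exp (4 * (norm b)\<^sup>2 / a)"
        by (simp flip: exp_add)
      then have "(2 * y) ^ m / fact m \<le> exp (1/4 * t) * exp (4 * (norm b)\<^sup>2 / a)"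
        using power_div_fact_le_exp[of "2 * y" m] y by linarith
      then have y_pow: "y ^ m / fact m \<le> (1 / 2) ^ m * (exp (1/4 * t) * exp (4 * (norm b)\<^sup>2 / a))"
        by (simp add: power_mult_distrib power_divide field_simps)
      \<comment> \<open>All dependence of the exponents on m is gathered into \<open>y ^ m\<close>;
        what is left of the powers of t and a has exponents depending only on
        \<open>\<sigma>\<close>.\<close>
      have "sqrt (t / a) ^ m = (t / a) powr (m / 2)"
        using t assms
        by (simp add: powr_half_sqrt[symmetric] powr_powr flip: powr_realpow)
      then have "y ^ m = norm b ^ m * (t powr (m / 2) * a powr - (m / 2))"
        using t assms by (simp add: y_def power_mult_distrib powr_divide powr_minus_divide)
      moreover have "norm (K * Gamma_integrand s t) =
          norm b ^ m / fact m * a powr - Re s * (t powr (Re s - 1) * exp (- t))"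
        using t assms
        by (simp only: norm_mult[of K] norm_Gamma_integrand)
          (simp add: K_def norm_mult norm_divide norm_power norm_powr_real_powr)
      moreover have "t powr (Re s - 1) = t powr (m / 2) * t powr (\<sigma> - 1)"
        "a powr - Re s = a powr - (m / 2) * a powr - \<sigma>"
        by (simp_all add: Re_s add_diff_eq flip: powr_add)
      ultimately have "norm (K * Gamma_integrand s t) =
          a powr - \<sigma> * (t powr (\<sigma> - 1) * (y ^ m / fact m) * exp (- t))"
        by simp
      also have "\<dots> \<le> a powr - \<sigma> * ((C * exp (1/4 * t)) *
          ((1 / 2) ^ m * (exp (1/4 * t) * exp (4 * (norm b)\<^sup>2 / a))) * exp (- t))"
        using C t y y_pow by (intro mult_left_mono mult_right_mono mult_mono) auto
      also have "\<dots> = B * (1 / 2) ^ m * (exp (1/4 * t) * exp (1/4 * t) * exp (- t))"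
        by (simp add: B_def mult_ac)
      also have "exp (1/4 * t) * exp (1/4 * t) * exp (- t) = exp (- (1/2) * t)"
        by (simp flip: exp_add)
      finally show ?thesis .
    qed
    have "norm (K * upper_Gamma s c) = norm (integral {c..} (\<lambda>t. K * Gamma_integrand s t))"
      by (simp add: upper_Gamma_def)
    also have "\<dots> \<le> integral {c..} (\<lambda>t. B * (1 / 2) ^ m * exp (- (1/2) * t))"
      using integrable_Gamma_integrand[OF c] int bound
      by (intro integral_norm_bound_integral integrable_on_mult_right) auto
    also have "\<dots> = B * J * (1 / 2) ^ m"
      by (simp add: J_def)
    finally have "norm (K * upper_Gamma s c) \<le> B * J * (1 / 2) ^ m" .
    moreover have "Upsilon_half_term \<upsilon> a b m x = - (K * upper_Gamma s c / 2)"
      by (simp add: Upsilon_half_term_def K_def s_def c_def)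
    ultimately show ?thesis
      using norm_ge_zero[of "K * upper_Gamma s c"]
      by (simp only: norm_minus_cancel norm_divide norm_numeral)
  qed
  then show ?thesis by blast
qed

lemma summable_Upsilon_half_term:
  assumes "a > 0" "x > 0"
  shows "summable (\<lambda>m. Upsilon_half_term \<upsilon> a b m x)"
proof -
  obtain C where "\<And>m. norm (Upsilon_half_term \<upsilon> a b m x) \<le> C * (1 / 2) ^ m"
    using Upsilon_half_term_bound[OF assms] by blast
  then show ?thesis
    by (rule summable_comparison_test'[rotated]) (intro summable_mult summable_geometric, simp)
qed

section \<open>Grouping in pairs and the derivative of the series\<close>

text \<open>Each term is the block of the half terms 2k and 2k + 1. Since the ungrouped series
  already converges, grouping it changes neither convergence nor the sum.\<close>

lemma Upsilon_term_sums:
  assumes "a > 0" "x > 0"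
  shows "Upsilon_term \<upsilon> a b x sums (\<Sum>m. Upsilon_half_term \<upsilon> a b m x)"
proof -
  have "(\<lambda>k. sum (\<lambda>m. Upsilon_half_term \<upsilon> a b m x) {k * 2..<k * 2 + 2})
      sums (\<Sum>m. Upsilon_half_term \<upsilon> a b m x)"
    by (intro sums_group summable_sums summable_Upsilon_half_term assms) simp
  moreover have "sum (\<lambda>m. Upsilon_half_term \<upsilon> a b m x) {k * 2..<k * 2 + 2}
      = Upsilon_term \<upsilon> a b x k" for k
    by (simp add: Upsilon_term_eq mult.commute)
  ultimately show ?thesis by simp
qed

lemma Upsilon_has_vector_derivative:
  assumes "a > 0" "x > 0"
  shows "(Upsilon \<upsilon> a b has_vector_derivative
    of_real x powr - \<upsilon> * exp (- of_real a * (of_real x)\<^sup>2 - b * of_real x)) (at x)"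
proof -
  \<comment> \<open>A neighbourhood of x bounded and bounded away from 0, so that the power and the
    exponential series have majorants uniform in u.\<close>
  define S where "S = {x / 2<..<2 * x}"
  have S: "open S" "convex S" "x \<in> S" and S_pos: "\<And>u. u \<in> S \<Longrightarrow> u > 0"
    using assms by (auto simp: S_def)
  define g where "g = (\<lambda>u. of_real u powr - \<upsilon> * exp (- of_real a * (of_real u)\<^sup>2) :: complex)"
  \<comment> \<open>This bounds the power on \<open>S\<close> whatever the sign of its exponent;
    there exp(u) is at most exp(2x).\<close>
  obtain C where C: "C > 0" "\<And>u. u \<ge> x / 2 \<Longrightarrow> u powr - Re \<upsilon> \<le> C * exp (1 * u)"
    using powr_le_const_mult_exp[of "x / 2" 1 "- Re \<upsilon>"] assms by auto
  have g_bound: "norm (g u) \<le> C * exp (2 * x)" if "u \<in> S" for u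
  proof -
    have "norm (g u) = u powr - Re \<upsilon> * exp (- a * u\<^sup>2)"
      using S_pos[OF that] by (simp add: g_def norm_mult norm_powr_real_powr flip: of_real_power)
    also have "\<dots> \<le> (C * exp u) * 1"
      using that C assms by (intro mult_mono) (auto simp: S_def)
    also have "\<dots> \<le> C * exp (2 * x)"
      using that C by (simp add: S_def)
    finally show ?thesis .
  qed
  have "((\<lambda>u. \<Sum>m. Upsilon_half_term \<upsilon> a b m u) has_vector_derivative
      (\<Sum>m. (- b * of_real x) ^ m / fact m * g x)) (at x)"
  proof (rule has_vector_derivative_suminf_M_test[OF S(1,2) _ _ _ S(3)])
    show "(Upsilon_half_term \<upsilon> a b m has_vector_derivative
        (- b * of_real u) ^ m / fact m * g u) (at u)" if "u \<in> S" for m u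
      unfolding g_def using assms(1) S_pos[OF that] by (rule Upsilon_half_term_has_vector_derivative)
    show "norm ((- b * of_real u) ^ m / fact m * g u)
        \<le> inverse (fact m) * (norm b * (2 * x)) ^ m * (C * exp (2 * x))" if "u \<in> S" for m u
    proof -
      have "norm ((- b * of_real u) ^ m / fact m * g u)
          = inverse (fact m) * (norm b * u) ^ m * norm (g u)"
        using S_pos[OF that] by (simp add: norm_mult norm_divide norm_power field_simps)
      also have "\<dots> \<le> inverse (fact m) * (norm b * (2 * x)) ^ m * (C * exp (2 * x))"
        using that S_pos[OF that] g_bound[OF that]
        by (intro mult_mono power_mono) (auto simp: S_def)
      finally show ?thesis .
    qed
    show "summable (\<lambda>m. inverse (fact m) * (norm b * (2 * x)) ^ m * (C * exp (2 * x)))"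
      by (intro summable_mult2 summable_exp)
    show "summable (\<lambda>m. Upsilon_half_term \<upsilon> a b m x)"
      using assms by (rule summable_Upsilon_half_term)
  qed
  moreover have "(\<Sum>m. (- b * of_real x) ^ m / fact m * g x)
      = of_real x powr - \<upsilon> * exp (- of_real a * (of_real x)\<^sup>2 - b * of_real x)"
  proof -
    have "(\<lambda>m. (- b * of_real x) ^ m / fact m * g x) sums (exp (- b * of_real x) * g x)"
      using exp_converges[of "- b * of_real x"]
      by (intro sums_mult2) (simp add: scaleR_conv_of_real field_simps)
    then show ?thesis
      by (simp add: sums_iff g_def exp_diff exp_minus field_simps)
  qed
  ultimately have "((\<lambda>u. \<Sum>m. Upsilon_half_term \<upsilon> a b m u) has_vector_derivative
      of_real x powr - \<upsilon> * exp (- of_real a * (of_real x)\<^sup>2 - b * of_real x)) (at x)"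
    by simp
  then show ?thesis
  proof (rule has_vector_derivative_transform_within_open[OF _ S(1,3)])
    show "(\<Sum>m. Upsilon_half_term \<upsilon> a b m u) = Upsilon \<upsilon> a b u" if "u \<in> S" for u
      using Upsilon_term_sums[OF assms(1) S_pos[OF that]] by (simp add: Upsilon_def sums_iff)
  qed
qed

section \<open>The Macdonald function of order 1/2\<close>

text \<open>Induction by the functional equation, starting from Gamma(1/2) = sqrt pi.\<close>

lemma rGamma_of_nat_plus_half:
  "rGamma (of_nat k + 1 / 2 :: complex)
     = 4 ^ k * fact k / (of_real (sqrt pi) * fact (2 * k))"
proof (induction k)
  case 0
  then show ?case by (simp add: rGamma_inverse_Gamma Gamma_one_half_complex field_simps)
next
  case (Suc k)
  define d :: complex where "d = of_nat k + 1 / 2"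
  have "d = of_real (real k + 1 / 2)" by (simp add: d_def)
  then have d: "d \<noteq> 0" by (simp only: of_real_eq_0_iff)
  have "of_nat (Suc k) + 1 / 2 = d + 1" by (simp add: d_def)
  then have "rGamma (of_nat (Suc k) + 1 / 2) = rGamma d / d"
    using rGamma_plus1[of d] d by (simp add: nonzero_eq_divide_eq mult.commute)
  also have "\<dots> = 4 ^ k * fact k / (of_real (sqrt pi) * fact (2 * k) * d)"
    using Suc by (simp add: d_def)
  also have "\<dots> = 4 ^ Suc k * fact (Suc k) / (of_real (sqrt pi) * (fact (2 * k) * (2 * d) * (2 * of_nat (Suc k))))"
    by (simp add: field_simps del: of_nat_Suc)
  \<comment> \<open>Here 2 d = 2k + 1, so the two new factors are (2k + 1)(2k + 2).\<close>
  also have "fact (2 * k) * (2 * d) * (2 * of_nat (Suc k)) = fact (2 * Suc k)"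
    by (simp add: d_def algebra_simps)
  finally show ?case .
qed

text \<open>Dividing by \<open>(z / 2) powr (1 / 2)\<close>, the principal power occurring in
  \<open>Bessel_I\<close>, avoids any choice of branch for sqrt(pi / (2 z)), so the formula covers
  the negative real axis too.\<close>

lemma Macdonald_K_half:
  fixes z :: complex
  assumes "z \<noteq> 0"
  shows "Macdonald_K (1 / 2) z = of_real (sqrt pi) / 2 * exp (- z) / (z / 2) powr (1 / 2)"
proof -
  define r where "r = (z / 2) powr (1 / 2)"
  define p :: complex where "p = of_real (sqrt pi)"
  have r2: "r * r = z / 2" using assms by (simp add: r_def flip: powr_add)
  have p2: "p * p = of_real pi" by (simp add: p_def flip: of_real_mult)
  have nz: "r \<noteq> 0" "p \<noteq> 0" using r2 assms by (auto simp: p_def)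
  have half_pow: "(z / 2) ^ (2 * k) = z ^ (2 * k) / 4 ^ k" for k
    by (simp add: power_divide power_mult)
  define e where "e = (\<lambda>n. z ^ n /\<^sub>R fact n)"
  \<comment> \<open>The 4^k and k! in the value of \<open>rGamma\<close> cancel the 4^k from
    (z/2)^(2k) and the k! of the Bessel series, leaving an even exponential term.\<close>
  have neg: "(z / 2) powr (- (1 / 2) + 2 * of_nat k) * rGamma (- (1 / 2) + of_nat k + 1) / fact k
      = 1 / (r * p) * e (2 * k)" for k
  proof -
    have "(z / 2) powr (- (1 / 2) + 2 * of_nat k) = (z / 2) powr - (1 / 2) * (z / 2) powr of_nat (2 * k)"
      by (simp only: powr_add of_nat_mult of_nat_numeral)
    also have "\<dots> = inverse r * (z / 2) ^ (2 * k)"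
      using assms by (subst powr_complexpow) (simp_all add: r_def powr_minus)
    finally have 1: "(z / 2) powr (- (1 / 2) + 2 * of_nat k) = inverse r * (z / 2) ^ (2 * k)" .
    have 2: "- (1 / 2) + of_nat k + 1 = of_nat k + 1 / (2::complex)" by simp
    show ?thesis
      unfolding 1 2 half_pow rGamma_of_nat_plus_half p_def[symmetric] e_def using nz
      by (simp add: scaleR_conv_of_real field_simps)
  qed
  \<comment> \<open>Now the half power is r = (z / 2) / r, which supplies the odd power of z with
    the same prefactor as before. The argument of \<open>rGamma\<close> is (k + 1) + 1/2, and the
    factor k + 1 in (k + 1)! cancels against (2k + 2)!.\<close>
  have pos: "(z / 2) powr (1 / 2 + 2 * of_nat k) * rGamma (1 / 2 + of_nat k + 1) / fact k
      = 1 / (r * p) * e (2 * k + 1)" for k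
  proof -
    have "(z / 2) powr (1 / 2 + 2 * of_nat k) = (z / 2) powr (1 / 2) * (z / 2) powr of_nat (2 * k)"
      by (simp only: powr_add of_nat_mult of_nat_numeral)
    also have "\<dots> = z / 2 / r * (z / 2) ^ (2 * k)"
      using assms nz r2 by (subst powr_complexpow) (simp_all add: r_def[symmetric] field_simps)
    finally have 1: "(z / 2) powr (1 / 2 + 2 * of_nat k) = z / 2 / r * (z / 2) ^ (2 * k)" .
    have 2: "1 / 2 + of_nat k + 1 = of_nat (Suc k) + 1 / (2::complex)" by simp
    have f: "fact (2 * Suc k) = 2 * of_nat (Suc k) * (fact (2 * k + 1) :: complex)"
      by (simp add: algebra_simps)
    have "of_nat (Suc k) \<noteq> (0::complex)" by (simp del: of_nat_Suc)
    then show ?thesis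
      unfolding 1 2 half_pow rGamma_of_nat_plus_half p_def[symmetric] e_def f fact_Suc[of k] using nz
      by (simp add: scaleR_conv_of_real field_simps
          del: of_nat_Suc fact_Suc)
  qed
  \<comment> \<open>The cosh and sinh series have zeros at the odd and even indices respectively, so
    each pair contains just one surviving term.\<close>
  have parts: "summable (\<lambda>k. e (2 * k))" "summable (\<lambda>k. e (2 * k + 1))"
    using sums_group[OF cosh_converges[of z], of 2] sums_group[OF sinh_converges[of z], of 2]
    by (auto simp: e_def mult.commute sums_iff)
  have "Bessel_I (- (1 / 2)) z - Bessel_I (1 / 2) z = 1 / (r * p) * (\<Sum>k. e (2 * k) - e (2 * k + 1))"
    unfolding Bessel_I_def neg pos using parts
    by (simp only: suminf_mult suminf_diff[symmetric] right_diff_distrib[symmetric])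
  also have "(\<lambda>k. e (2 * k) - e (2 * k + 1)) sums exp (- z)"
  proof -
    \<comment> \<open>Even minus odd terms are the pairs of consecutive terms in the series of
      exp(-z).\<close>
    have "(\<lambda>k. sum (\<lambda>n. (- z) ^ n /\<^sub>R fact n) {k * 2..<k * 2 + 2}) sums exp (- z)"
      by (intro sums_group exp_converges) simp
    then show ?thesis by (simp add: e_def mult.commute)
  qed
  then have "(\<Sum>k. e (2 * k) - e (2 * k + 1)) = exp (- z)" by (rule sums_unique[symmetric])
  finally have diff: "Bessel_I (- (1 / 2)) z - Bessel_I (1 / 2) z = 1 / (r * p) * exp (- z)" .
  \<comment> \<open>At a non-integer order \<open>Macdonald_K\<close> is the plain quotient, with no
    limit in the order.\<close>
  have "(1 / 2 :: complex) \<notin> \<int>"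
    using fraction_not_in_Ints[of 2 1, where 'a = complex] by simp
  then have "Macdonald_K (1 / 2) z
      = of_real pi / 2 * (1 / (r * p) * exp (- z)) / sin (of_real pi * (1 / 2))"
    by (simp only: Macdonald_K_def Macdonald_quotient_def diff if_False)
  also have "sin (of_real pi * (1 / 2) :: complex) = 1"
  proof -
    have "sin (of_real pi * (1 / 2) :: complex) = of_real (sin (pi / 2))"
      by (simp add: sin_of_real[symmetric] del: sin_pi_half)
    then show ?thesis by simp
  qed
  also have "of_real pi / 2 * (1 / (r * p) * exp (- z)) / 1 = p / 2 * exp (- z) / r"
    unfolding p2[symmetric] using nz by simp
  finally show ?thesis by (simp add: r_def p_def)
qed

text \<open>For positive \<beta> and x all half powers are real square roots, and their product with
  the prefactor of K_(1/2)(\<beta> x) is 1; only x^(-\<upsilon>) stays complex.\<close>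

lemma exp_minus_eq_Macdonald_K_half:
  fixes \<upsilon> :: complex
  assumes "\<beta> > 0" "x > 0"
  shows "of_real x powr - \<upsilon> * exp (- of_real (\<beta> * x))
    = of_real (sqrt (2 / pi)) * of_real \<beta> powr (1 / 2) * of_real x powr (1 / 2 - \<upsilon>)
      * Macdonald_K (1 / 2) (of_real (\<beta> * x))"
proof -
  have half: "complex_of_real u powr (1 / 2) = of_real (sqrt u)" if "u > 0" for u
    using that by (simp add: csqrt_of_real flip: csqrt_conv_powr)
  have K: "Macdonald_K (1 / 2) (of_real (\<beta> * x))
      = of_real (sqrt pi / (2 * sqrt (\<beta> * x / 2))) * exp (- of_real (\<beta> * x))"
    using assms half[of "\<beta> * x / 2"] by (subst Macdonald_K_half) auto
  have x: "of_real x powr (1 / 2 - \<upsilon>) = of_real (sqrt x) * of_real x powr - \<upsilon>"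
    using half[OF assms(2)] by (simp add: powr_diff powr_minus_divide)
  have "sqrt (2 / pi) * sqrt \<beta> * sqrt x * (sqrt pi / (2 * sqrt (\<beta> * x / 2))) = 1"
    using assms by (simp add: real_sqrt_divide real_sqrt_mult field_simps)
  then have "of_real (sqrt (2 / pi)) * of_real (sqrt \<beta>) * of_real (sqrt x)
      * of_real (sqrt pi / (2 * sqrt (\<beta> * x / 2))) = (1 :: complex)"
    by (simp only: flip: of_real_mult) simp
  then show ?thesis
    unfolding K x half[OF assms(1)] by algebra
qed

section \<open>Convergence, antiderivative and Bessel form of the integrand\<close>

theorem mainTheorem1:
  fixes a :: real and b \<upsilon> :: complex
  assumes "a > 0"
  shows "(\<forall>x>0. summable (Upsilon_term \<upsilon> a b x)) \<and>
    antiderivative_on_pos (Upsilon \<upsilon> a b)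
      (\<lambda>x. of_real x powr (- \<upsilon>) * exp (- of_real a * (of_real x)\<^sup>2 - b * of_real x)) \<and>
    (b \<in> \<real> \<and> Re b > 0 \<longrightarrow>
      (\<forall>x::real>0.
        of_real x powr (- \<upsilon>) * exp (- of_real a * (of_real x)\<^sup>2 - b * of_real x) =
        of_real (sqrt (2 / pi)) * exp (- of_real a * (of_real x)\<^sup>2) * b powr (1 / 2)
          * of_real x powr (1 / 2 - \<upsilon>) * Macdonald_K (1 / 2) (b * of_real x)) \<and>
      antiderivative_on_pos (Upsilon \<upsilon> a b)
        (\<lambda>x. of_real (sqrt (2 / pi)) * exp (- of_real a * (of_real x)\<^sup>2) * b powr (1 / 2)
          * of_real x powr (1 / 2 - \<upsilon>) * Macdonald_K (1 / 2) (b * of_real x)))"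
proof (intro conjI impI allI)
  let ?f = "\<lambda>x. of_real x powr - \<upsilon> * exp (- of_real a * (of_real x)\<^sup>2 - b * of_real x)"
  let ?g = "\<lambda>x. of_real (sqrt (2 / pi)) * exp (- of_real a * (of_real x)\<^sup>2) * b powr (1 / 2)
          * of_real x powr (1 / 2 - \<upsilon>) * Macdonald_K (1 / 2) (b * of_real x)"
  show "summable (Upsilon_term \<upsilon> a b x)" if "x > 0" for x
    using Upsilon_term_sums[OF assms that] by (rule sums_summable)
  show "antiderivative_on_pos (Upsilon \<upsilon> a b) ?f"
    unfolding antiderivative_on_pos_def using Upsilon_has_vector_derivative[OF assms] by blast
  show eq: "?f x = ?g x" if "b \<in> \<real> \<and> Re b > 0" "x > 0" for x
  proof -
    \<comment> \<open>Writing \<open>b\<close> as a real number allows the identity for real \<beta>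
      to be applied with \<beta> = \<open>Re b\<close>, after splitting off exp(-a x^2).\<close>
    have b: "b = of_real (Re b)" and "Re b > 0" using that by auto
    have "?f x = exp (- of_real a * (of_real x)\<^sup>2)
        * (of_real x powr - \<upsilon> * exp (- of_real (Re b * x)))"
      by (subst b) (simp add: exp_diff exp_minus divide_inverse)
    also have "\<dots> = ?g x"
      unfolding exp_minus_eq_Macdonald_K_half[OF \<open>Re b > 0\<close> \<open>x > 0\<close>]
      unfolding of_real_mult b[symmetric]
      by (simp only: mult_ac)
    finally show ?thesis .
  qed
  show "antiderivative_on_pos (Upsilon \<upsilon> a b) ?g" if "b \<in> \<real> \<and> Re b > 0"
    unfolding antiderivative_on_pos_def
  proof (intro allI impI)
    fix x :: real assume "x > 0"
    then show "(Upsilon \<upsilon> a b has_vector_derivative ?g x) (at x)"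
      unfolding eq[OF that \<open>x > 0\<close>, symmetric]
      by (rule Upsilon_has_vector_derivative[OF assms])
  qed
qed

end
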